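(* Let $(M,L)$ be a Finsler space and let $\overline L=L+\beta$ be a generalized Randers change. If $(M,L)$ satisfies the b-condition $b^iC_{ijk}=0$, then the generalized Randers space $(M,\overline L)$ cannot satisfy the b-condition, i.e. $b^i\overline C_{ijk}=0$ does not hold.
   Context: $(M,L)$ is an $n$-dimensional smooth Finsler manifold; $\dot\partial_i=\partial/\partial y^i$, $g_{ij}=\frac12\dot\partial_i\dot\partial_jL^2$, $y_i=g_{ij}y^j$, $C_{ijk}=\frac12\dot\partial_kg_{ij}$. A generalized Randers change is $L\mapsto\overline L=L+\beta$, with $L$ Finslerian and $\beta=b_i(x)y^i$ given by a 1-form; it is assumed that $(M,\overline L)$ is a Finsler space, with Cartan tensor $\overline C_{ijk}$. Notation: $b^i=g^{ij}b_j$. Standing assumption: $m_i:=b_i-(\beta/L^2)y_i\neq0$ and $m^2:=g^{ij}m_im_j\neq0$ at the points $(x,y)$ under consideration. *)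

theory Defs
  imports "HOL-Analysis.Analysis"
begin

section \<open>Smooth maps on open sets\<close>

primrec Ck_on ::
  "nat \<Rightarrow> 'a::real_normed_vector set \<Rightarrow> ('a \<Rightarrow> 'b::real_normed_vector) \<Rightarrow> bool" where
  "Ck_on 0 S f \<longleftrightarrow> continuous_on S f"
| "Ck_on (Suc k) S f \<longleftrightarrow>
     (\<forall>x\<in>S. f differentiable (at x)) \<and> (\<forall>v. Ck_on k S (\<lambda>x. frechet_derivative f (at x) v))"

definition smooth_on :: "'a::real_normed_vector set \<Rightarrow> ('a \<Rightarrow> 'b::real_normed_vector) \<Rightarrow> bool" where
  "smooth_on S f \<longleftrightarrow> open S \<and> (\<forall>k. Ck_on k S f)"


section \<open>Smooth manifolds, tangent vectors\<close>

text \<open>The manifold is a Hausdorff, second countable type \<open>'m\<close> with an atlas of charts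
  into \<open>real ^ 'n\<close>. A chart is a pair of its domain and its coordinate map; the values of the
  map outside the domain are never used.\<close>

type_synonym ('m, 'n) chart = "'m set \<times> ('m \<Rightarrow> real ^ 'n)"

definition is_chart :: "('m::topological_space, 'n::finite) chart \<Rightarrow> bool" where
  "is_chart c \<longleftrightarrow> open (fst c) \<and> open (snd c ` fst c) \<and>
     (\<exists>g. homeomorphism (fst c) (snd c ` fst c) (snd c) g)"

definition transition :: "('m, 'n) chart \<Rightarrow> ('m, 'n) chart \<Rightarrow> real ^ 'n \<Rightarrow> real ^ 'n" where
  "transition c d = snd d \<circ> inv_into (fst c) (snd c)"

definition smooth_atlas ::
  "('m::{t2_space, second_countable_topology}, 'n::finite) chart set \<Rightarrow> bool" where
  "smooth_atlas A \<longleftrightarrow> (\<forall>c\<in>A. is_chart c) \<and> (\<Union>c\<in>A. fst c) = UNIV \<and>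
     (\<forall>c\<in>A. \<forall>d\<in>A. smooth_on (snd c ` (fst c \<inter> fst d)) (transition c d))"

text \<open>A tangent vector at \<open>p\<close> is the family of its component vectors in all charts around
  \<open>p\<close>, related by the Jacobians of the transition maps; the family is set to 0 at all other
  pairs so that equality of tangent vectors is equality of functions. The vector space operations
  are pointwise.\<close>

type_synonym ('m, 'n) tangent = "('m, 'n) chart \<Rightarrow> real ^ 'n"

definition tangent_space ::
  "('m, 'n::finite) chart set \<Rightarrow> 'm \<Rightarrow> ('m, 'n) tangent set" where
  "tangent_space A p = {v.
     (\<forall>c\<in>A. \<forall>d\<in>A. p \<in> fst c \<and> p \<in> fst d \<longrightarrow>
        v d = frechet_derivative (transition c d) (at (snd c p)) (v c)) \<and>
     (\<forall>c. c \<notin> A \<or> p \<notin> fst c \<longrightarrow> v c = 0)}"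

definition slit_tangent_bundle ::
  "('m, 'n::finite) chart set \<Rightarrow> ('m \<times> ('m, 'n) tangent) set" where
  "slit_tangent_bundle A = {(p, v). v \<in> tangent_space A p \<and> v \<noteq> (\<lambda>_. 0)}"

text \<open>The tangent vector at \<open>p\<close> whose components in the chart \<open>c\<close> are \<open>y\<close>.\<close>

definition tangent_of ::
  "('m, 'n::finite) chart set \<Rightarrow> ('m, 'n) chart \<Rightarrow> 'm \<Rightarrow> real ^ 'n \<Rightarrow> ('m, 'n) tangent" where
  "tangent_of A c p y = (\<lambda>d. if d \<in> A \<and> p \<in> fst d
      then frechet_derivative (transition c d) (at (snd c p)) y else 0)"

definition coords :: "('m, 'n) chart \<Rightarrow> 'm \<times> ('m, 'n) tangent \<Rightarrow> (real ^ 'n) \<times> (real ^ 'n)" where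
  "coords c z = (snd c (fst z), snd z c)"

text \<open>The expression \<open>F(x, y)\<close> of a function \<open>F\<close> on the tangent bundle in the bundle
  coordinates induced by the chart \<open>c\<close>.\<close>

definition local_expr ::
  "('m, 'n::finite) chart set \<Rightarrow> ('m, 'n) chart \<Rightarrow> ('m \<times> ('m, 'n) tangent \<Rightarrow> real)
     \<Rightarrow> (real ^ 'n) \<times> (real ^ 'n) \<Rightarrow> real" where
  "local_expr A c F = (\<lambda>(x, y). let p = inv_into (fst c) (snd c) x in F (p, tangent_of A c p y))"


section \<open>Finsler geometry in bundle coordinates\<close>

text \<open>In this section \<open>L\<close> and \<open>\<beta>\<close> are coordinate expressions of functions on the tangent
  bundle, and a point \<open>z\<close> is a pair \<open>(x, y)\<close>.\<close>

definition ydot ::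
  "'n::finite \<Rightarrow> ((real ^ 'n) \<times> (real ^ 'n) \<Rightarrow> real) \<Rightarrow> (real ^ 'n) \<times> (real ^ 'n) \<Rightarrow> real" where
  "ydot i f = (\<lambda>(x, y). deriv (\<lambda>t. f (x, y + t *\<^sub>R axis i 1)) 0)"

definition metric ::
  "((real ^ 'n::finite) \<times> (real ^ 'n) \<Rightarrow> real) \<Rightarrow> (real ^ 'n) \<times> (real ^ 'n) \<Rightarrow> real ^ 'n ^ 'n" where
  "metric L z = (\<chi> i j. 1/2 * ydot i (ydot j (\<lambda>w. (L w)\<^sup>2)) z)"

definition metric_inv ::
  "((real ^ 'n::finite) \<times> (real ^ 'n) \<Rightarrow> real) \<Rightarrow> (real ^ 'n) \<times> (real ^ 'n) \<Rightarrow> real ^ 'n ^ 'n" where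
  "metric_inv L z = matrix_inv (metric L z)"

definition cartan ::
  "((real ^ 'n::finite) \<times> (real ^ 'n) \<Rightarrow> real) \<Rightarrow> 'n \<Rightarrow> 'n \<Rightarrow> 'n \<Rightarrow> (real ^ 'n) \<times> (real ^ 'n) \<Rightarrow> real" where
  "cartan L i j k z = 1/2 * ydot k (\<lambda>w. metric L w $ i $ j) z"

definition y_lower ::
  "((real ^ 'n::finite) \<times> (real ^ 'n) \<Rightarrow> real) \<Rightarrow> (real ^ 'n) \<times> (real ^ 'n) \<Rightarrow> real ^ 'n" where
  "y_lower L z = (\<chi> i. \<Sum>j\<in>UNIV. metric L z $ i $ j * snd z $ j)"

text \<open>Components \<open>b\<^sub>i(x) = \<beta>(x, \<partial>\<^sub>i)\<close> of a 1-form given as a function on the tangent bundle.\<close>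

definition b_lower ::
  "((real ^ 'n::finite) \<times> (real ^ 'n) \<Rightarrow> real) \<Rightarrow> real ^ 'n \<Rightarrow> real ^ 'n" where
  "b_lower \<beta> x = (\<chi> i. \<beta> (x, axis i 1))"

definition b_upper ::
  "((real ^ 'n::finite) \<times> (real ^ 'n) \<Rightarrow> real) \<Rightarrow> ((real ^ 'n) \<times> (real ^ 'n) \<Rightarrow> real)
     \<Rightarrow> (real ^ 'n) \<times> (real ^ 'n) \<Rightarrow> real ^ 'n" where
  "b_upper L \<beta> z = (\<chi> i. \<Sum>j\<in>UNIV. metric_inv L z $ i $ j * b_lower \<beta> (fst z) $ j)"

definition m_lower ::
  "((real ^ 'n::finite) \<times> (real ^ 'n) \<Rightarrow> real) \<Rightarrow> ((real ^ 'n) \<times> (real ^ 'n) \<Rightarrow> real)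
     \<Rightarrow> (real ^ 'n) \<times> (real ^ 'n) \<Rightarrow> real ^ 'n" where
  "m_lower L \<beta> z = (\<chi> i. b_lower \<beta> (fst z) $ i - \<beta> z / (L z)\<^sup>2 * y_lower L z $ i)"

definition m_square ::
  "((real ^ 'n::finite) \<times> (real ^ 'n) \<Rightarrow> real) \<Rightarrow> ((real ^ 'n) \<times> (real ^ 'n) \<Rightarrow> real)
     \<Rightarrow> (real ^ 'n) \<times> (real ^ 'n) \<Rightarrow> real" where
  "m_square L \<beta> z =
     (\<Sum>i\<in>UNIV. \<Sum>j\<in>UNIV. metric_inv L z $ i $ j * m_lower L \<beta> z $ i * m_lower L \<beta> z $ j)"


section \<open>Finsler spaces and the b-condition\<close>

text \<open>The metric tensor is required to be nondegenerate on the slit tangent bundle; Finsler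
  spaces with positive definite metric tensor are included.\<close>

definition finsler_space ::
  "('m::{t2_space, second_countable_topology}, 'n::finite) chart set
     \<Rightarrow> ('m \<times> ('m, 'n) tangent \<Rightarrow> real) \<Rightarrow> bool" where
  "finsler_space A L \<longleftrightarrow> smooth_atlas A \<and>
     (\<forall>c\<in>A. smooth_on (snd c ` fst c \<times> (UNIV - {0})) (local_expr A c L)) \<and>
     (\<forall>z\<in>slit_tangent_bundle A. L z > 0) \<and>
     (\<forall>p. \<forall>v\<in>tangent_space A p. \<forall>r>0. L (p, \<lambda>c. r *\<^sub>R v c) = r * L (p, v)) \<and>
     (\<forall>c\<in>A. \<forall>x\<in>snd c ` fst c. \<forall>y. y \<noteq> 0 \<longrightarrow> invertible (metric (local_expr A c L) (x, y)))"

definition smooth_one_form ::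
  "('m::{t2_space, second_countable_topology}, 'n::finite) chart set
     \<Rightarrow> ('m \<times> ('m, 'n) tangent \<Rightarrow> real) \<Rightarrow> bool" where
  "smooth_one_form A \<beta> \<longleftrightarrow>
     (\<forall>p. \<forall>v\<in>tangent_space A p. \<forall>w\<in>tangent_space A p.
        \<beta> (p, \<lambda>c. v c + w c) = \<beta> (p, v) + \<beta> (p, w)) \<and>
     (\<forall>p. \<forall>v\<in>tangent_space A p. \<forall>r. \<beta> (p, \<lambda>c. r *\<^sub>R v c) = r * \<beta> (p, v)) \<and>
     (\<forall>c\<in>A. smooth_on (snd c ` fst c) (b_lower (local_expr A c \<beta>)))"

definition randers_change ::
  "('m \<times> ('m, 'n) tangent \<Rightarrow> real) \<Rightarrow> ('m \<times> ('m, 'n) tangent \<Rightarrow> real)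
     \<Rightarrow> 'm \<times> ('m, 'n) tangent \<Rightarrow> real" where
  "randers_change L \<beta> = (\<lambda>z. L z + \<beta> z)"

text \<open>\<open>b\<^sup>i C\<^sub>i\<^sub>j\<^sub>k = 0\<close> at all points of \<open>D\<close>, where \<open>C\<close> is the Cartan tensor of \<open>F\<close> and
  \<open>b\<^sup>i = g\<^sup>i\<^sup>j b\<^sub>j\<close> with \<open>g\<close> the metric tensor of \<open>L\<close>. The index is raised with \<open>L\<close>
  also when \<open>F\<close> is the changed metric.\<close>

definition b_condition ::
  "('m::{t2_space, second_countable_topology}, 'n::finite) chart set
     \<Rightarrow> ('m \<times> ('m, 'n) tangent) set
     \<Rightarrow> ('m \<times> ('m, 'n) tangent \<Rightarrow> real) \<Rightarrow> ('m \<times> ('m, 'n) tangent \<Rightarrow> real)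
     \<Rightarrow> ('m \<times> ('m, 'n) tangent \<Rightarrow> real) \<Rightarrow> bool" where
  "b_condition A D L \<beta> F \<longleftrightarrow>
     (\<forall>z\<in>D. \<forall>c\<in>A. fst z \<in> fst c \<longrightarrow> (\<forall>j k.
        (\<Sum>i\<in>UNIV. b_upper (local_expr A c L) (local_expr A c \<beta>) (coords c z) $ i *
                  cartan (local_expr A c F) i j k (coords c z)) = 0))"

text \<open>The standing assumption at the points of \<open>D\<close>.\<close>

definition m_nonzero_on ::
  "('m::{t2_space, second_countable_topology}, 'n::finite) chart set
     \<Rightarrow> ('m \<times> ('m, 'n) tangent) set
     \<Rightarrow> ('m \<times> ('m, 'n) tangent \<Rightarrow> real) \<Rightarrow> ('m \<times> ('m, 'n) tangent \<Rightarrow> real) \<Rightarrow> bool" where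
  "m_nonzero_on A D L \<beta> \<longleftrightarrow>
     (\<forall>z\<in>D. \<forall>c\<in>A. fst z \<in> fst c \<longrightarrow>
        m_lower (local_expr A c L) (local_expr A c \<beta>) (coords c z) \<noteq> 0 \<and>
        m_square (local_expr A c L) (local_expr A c \<beta>) (coords c z) \<noteq> 0)"

end

theory Submission
  imports Defs
begin

text \<open>
  Everything happens at one point \<open>(x, y)\<close> of one chart. Write \<open>L\<^sub>i\<close>, \<open>L\<^sub>i\<^sub>j\<close>, \<open>L\<^sub>i\<^sub>j\<^sub>k\<close> for the
  fibre derivatives of \<open>L\<close>, and let an index \<open>b\<close> denote contraction with \<open>b\<^sup>i\<close>. Differentiating
  \<open>L\<^sup>2\<close> three times gives
  \<open>2 C\<^sub>i\<^sub>j\<^sub>k = L L\<^sub>i\<^sub>j\<^sub>k + L\<^sub>k L\<^sub>i\<^sub>j + L\<^sub>i L\<^sub>j\<^sub>k + L\<^sub>j L\<^sub>i\<^sub>k\<close>, hence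
  \<open>2 C\<^sub>b\<^sub>b\<^sub>b = L L\<^sub>b\<^sub>b\<^sub>b + 3 L\<^sub>b L\<^sub>b\<^sub>b\<close> (lemma \<open>cartan_contract\<close>).
  The change \<open>L \<mapsto> L + \<beta>\<close> adds a term linear in \<open>y\<close>, so it turns \<open>L\<^sub>b\<close> into \<open>L\<^sub>b + b\<^sup>i b\<^sub>i\<close> and leaves \<open>L\<^sub>b\<^sub>b\<close>
  and \<open>L\<^sub>b\<^sub>b\<^sub>b\<close> alone. Homogeneity of \<open>L\<close> yields \<open>L\<^sub>b = \<beta> / L\<close>, \<open>m\<^sup>2 = b\<^sup>i b\<^sub>i - \<beta>\<^sup>2 / L\<^sup>2\<close> and
  \<open>L\<^sub>b\<^sub>b = m\<^sup>2 / L\<close>. Eliminating \<open>L\<^sub>b\<^sub>b\<^sub>b\<close> between the Cartan tensor \<open>C\<close> of \<open>L\<close> and the Cartan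
  tensor \<open>C'\<close> of \<open>L + \<beta>\<close> leaves
  \<open>2 C'\<^sub>b\<^sub>b\<^sub>b = 2 (1 + \<beta> / L) C\<^sub>b\<^sub>b\<^sub>b + 3 m\<^sup>4 / L\<close> (lemma \<open>randers_cartan_contract\<close>).
  Both b-conditions together would make both contractions vanish and force \<open>m\<^sup>2 = 0\<close>.
\<close>

section \<open>Smooth maps and fibre derivatives\<close>

lemma Ck_on_cong:
  assumes "open S" "\<And>x. x \<in> S \<Longrightarrow> f x = g x" "Ck_on k S f"
  shows "Ck_on k S g"
  using assms(2,3)
proof (induction k arbitrary: f g)
  case 0
  then show ?case by (simp cong: continuous_on_cong)
next
  case (Suc k)
  have der: "(g has_derivative frechet_derivative f (at x)) (at x)" if "x \<in> S" for x
  proof -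
    have "(f has_derivative frechet_derivative f (at x)) (at x)"
      using Suc.prems(2) that by (simp add: frechet_derivative_works[symmetric])
    then show ?thesis
      by (rule has_derivative_transform_within_open[OF _ \<open>open S\<close> that]) (rule Suc.prems(1))
  qed
  have "Ck_on k S (\<lambda>x. frechet_derivative g (at x) v)" for v
  proof (rule Suc.IH)
    show "Ck_on k S (\<lambda>x. frechet_derivative f (at x) v)"
      using Suc.prems(2) by simp
    show "frechet_derivative f (at x) v = frechet_derivative g (at x) v" if "x \<in> S" for x
      using frechet_derivative_at[OF der[OF that]] by simp
  qed
  moreover have "g differentiable (at x)" if "x \<in> S" for x
    using der[OF that] by (auto simp: differentiable_def)
  ultimately show ?case by simp
qed

lemma smooth_on_differentiable:
  assumes "smooth_on S f" "x \<in> S"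
  shows "f differentiable (at x)"
proof -
  have "Ck_on (Suc 0) S f" using assms(1) unfolding smooth_on_def by blast
  then show ?thesis using assms(2) by simp
qed

lemma smooth_on_open: "smooth_on S f \<Longrightarrow> open S"
  by (simp add: smooth_on_def)

lemma smooth_on_frechet:
  assumes "smooth_on S f"
  shows "smooth_on S (\<lambda>x. frechet_derivative f (at x) v)"
proof -
  have "Ck_on (Suc k) S f" for k using assms unfolding smooth_on_def by blast
  then show ?thesis using assms by (simp add: smooth_on_def)
qed

lemma differentiable_fibre_line:
  assumes "f differentiable (at (x, y))"
  shows "((\<lambda>t. f (x, y + t *\<^sub>R v)) has_field_derivative
    frechet_derivative f (at (x, y)) (0, v)) (at 0)"
proof -
  let ?f' = "frechet_derivative f (at (x, y))"
  have f': "(f has_derivative ?f') (at (x, y))"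
    using assms by (simp add: frechet_derivative_works[symmetric])
  have "((\<lambda>t::real. (x, y + t *\<^sub>R v)) has_derivative (\<lambda>t. (0, t *\<^sub>R v))) (at 0)"
    by (auto intro!: derivative_eq_intros)
  then have "((\<lambda>t. f (x, y + t *\<^sub>R v)) has_derivative (\<lambda>t. ?f' (0, t *\<^sub>R v))) (at 0)"
    using has_derivative_compose[of "\<lambda>t::real. (x, y + t *\<^sub>R v)" _ 0 UNIV f ?f'] f' by simp
  moreover have "?f' (0, t *\<^sub>R v) = ?f' (0, v) * t" for t :: real
    using linear_scale[OF has_derivative_linear[OF f'], of t "(0, v)"] by simp
  ultimately show ?thesis
    by (simp add: has_field_derivative_def mult_commute_abs)
qed

lemma ydot_eq_frechet:
  assumes "f differentiable (at z)"
  shows "ydot i f z = frechet_derivative f (at z) (0, axis i 1)"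
proof (cases z)
  case (Pair x y)
  from differentiable_fibre_line[OF assms[unfolded Pair]] show ?thesis
    unfolding ydot_def Pair by (simp add: DERIV_imp_deriv)
qed

text \<open>The Cartan tensor involves iterated fibre derivatives of \<open>L\<close>. This lemma makes each iterate
  smooth again, hence differentiable, so that the product rule applies at every stage.\<close>

lemma smooth_on_ydot:
  assumes "smooth_on S f"
  shows "smooth_on S (ydot i f)"
proof -
  have eq: "frechet_derivative f (at z) (0, axis i 1) = ydot i f z" if "z \<in> S" for z
    using ydot_eq_frechet[OF smooth_on_differentiable[OF assms that]] by simp
  have "Ck_on k S (ydot i f)" for k
    using smooth_on_frechet[OF assms, of "(0, axis i 1)"] unfolding smooth_on_def
    by (intro Ck_on_cong[OF _ eq]) simp_all
  then show ?thesis
    using smooth_on_open[OF assms] by (simp add: smooth_on_def)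
qed

lemma ydot_mult:
  assumes "f differentiable (at z)" "g differentiable (at z)"
  shows "ydot i (\<lambda>w. f w * g w) z = f z * ydot i g z + ydot i f z * g z"
proof -
  have d: "((\<lambda>w. f w * g w) has_derivative
      (\<lambda>h. f z * frechet_derivative g (at z) h + frechet_derivative f (at z) h * g z)) (at z)"
    using assms by (intro has_derivative_mult) (simp_all add: frechet_derivative_works[symmetric])
  then have "(\<lambda>w. f w * g w) differentiable (at z)" by (auto simp: differentiable_def)
  then show ?thesis
    using assms frechet_derivative_at[OF d] by (simp add: ydot_eq_frechet fun_eq_iff)
qed

lemma ydot_add:
  assumes "f differentiable (at z)" "g differentiable (at z)"
  shows "ydot i (\<lambda>w. f w + g w) z = ydot i f z + ydot i g z"
proof -
  have d: "((\<lambda>w. f w + g w) has_derivative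
      (\<lambda>h. frechet_derivative f (at z) h + frechet_derivative g (at z) h)) (at z)"
    using assms by (intro has_derivative_add) (simp_all add: frechet_derivative_works[symmetric])
  then have "(\<lambda>w. f w + g w) differentiable (at z)" by (auto simp: differentiable_def)
  then show ?thesis
    using assms frechet_derivative_at[OF d] by (simp add: ydot_eq_frechet fun_eq_iff)
qed

text \<open>The rule for adding a 1-form. Since \<open>ydot\<close> sees only the line through \<open>(x, y)\<close> in the fibre,
  it is enough that \<open>g\<close> is affine along that line.\<close>

lemma ydot_add_affine:
  assumes "f differentiable (at (x, y))"
    and "\<And>t. g (x, y + t *\<^sub>R axis i 1) = g (x, y) + t * c"
  shows "ydot i (\<lambda>w. f w + g w) (x, y) = ydot i f (x, y) + c"
proof -
  let ?f' = "frechet_derivative f (at (x, y))"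
  have "((\<lambda>t. f (x, y + t *\<^sub>R axis i 1)) has_field_derivative ?f' (0, axis i 1)) (at 0)"
    by (rule differentiable_fibre_line[OF assms(1)])
  then have "((\<lambda>t. f (x, y + t *\<^sub>R axis i 1) + g (x, y + t *\<^sub>R axis i 1))
      has_field_derivative ?f' (0, axis i 1) + c) (at 0)"
    unfolding assms(2) by (auto intro!: derivative_eq_intros)
  then show ?thesis
    using ydot_eq_frechet[OF assms(1), of i] by (simp add: ydot_def DERIV_imp_deriv)
qed

lemma ydot_cong:
  assumes "open S" "z \<in> S" "\<And>w. w \<in> S \<Longrightarrow> f w = g w"
  shows "ydot i f z = ydot i g z"
proof (cases z)
  case (Pair x y)
  let ?l = "\<lambda>t::real. (x, y + t *\<^sub>R axis i 1)"
  have "open (?l -` S)"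
    by (intro open_vimage assms(1) continuous_intros)
  moreover have "0 \<in> ?l -` S" using assms(2) Pair by simp
  ultimately have "\<forall>\<^sub>F t in nhds 0. t \<in> ?l -` S"
    by (rule eventually_nhds_in_open)
  then have "\<forall>\<^sub>F t in nhds 0. f (?l t) = g (?l t)"
    by eventually_elim (use assms(3) in auto)
  then show ?thesis unfolding ydot_def Pair by (simp add: deriv_cong_ev)
qed


section \<open>Homogeneity\<close>

lemma frechet_fibre_eq_sum_ydot:
  assumes "f differentiable (at (x, y))"
  shows "frechet_derivative f (at (x, y)) (0, v) = (\<Sum>j\<in>UNIV. v $ j * ydot j f (x, y))"
proof -
  let ?f' = "frechet_derivative f (at (x, y))"
  have lin: "linear ?f'"
    using assms by (simp add: linear_frechet_derivative)
  have "(0 :: real ^ 'a, v) = (\<Sum>j\<in>UNIV. v $ j *\<^sub>R (0, axis j 1))"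
  proof -
    have "v = (\<Sum>j\<in>UNIV. v $ j *\<^sub>R axis j 1)"
      by (simp add: vec_eq_iff axis_def if_distrib cong: if_cong)
    then show ?thesis by (simp add: prod_eq_iff fst_sum snd_sum)
  qed
  then have "?f' (0, v) = (\<Sum>j\<in>UNIV. v $ j * ?f' (0, axis j 1))"
    by (simp only: linear_sum[OF lin] linear_scale[OF lin] real_scaleR_def)
  then show ?thesis using assms by (simp add: ydot_eq_frechet)
qed

text \<open>Euler's relation for functions of degree \<open>k\<close>: both sides are the derivative of
  \<open>t \<mapsto> f (x, (1 + t) y)\<close> at 0. It is used with \<open>k = 1\<close> for \<open>L\<close> and \<open>k = 0\<close> for its first fibre
  derivatives.\<close>

lemma euler_relation:
  assumes "f differentiable (at (x, y))"
    and "\<And>r. r > 0 \<Longrightarrow> f (x, r *\<^sub>R y) = r ^ k * f (x, y)"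
  shows "(\<Sum>j\<in>UNIV. y $ j * ydot j f (x, y)) = real k * f (x, y)"
proof -
  let ?f' = "frechet_derivative f (at (x, y))"
  have "((\<lambda>t. f (x, y + t *\<^sub>R y)) has_field_derivative ?f' (0, y)) (at 0)"
    by (rule differentiable_fibre_line[OF assms(1)])
  moreover have *: "((\<lambda>t. (1 + t) ^ k * f (x, y)) has_field_derivative real k * f (x, y)) (at 0)"
    by (auto intro!: derivative_eq_intros)
  have "((\<lambda>t. f (x, y + t *\<^sub>R y)) has_field_derivative real k * f (x, y)) (at 0)"
  proof -
    have "\<forall>\<^sub>F t::real in nhds 0. t \<in> {-1<..}"
      by (rule eventually_nhds_in_open) auto
    then have "\<forall>\<^sub>F t in nhds 0. (1 + t) ^ k * f (x, y) = f (x, y + t *\<^sub>R y)"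
    proof eventually_elim
      case (elim t)
      have "y + t *\<^sub>R y = (1 + t) *\<^sub>R y" by (simp add: scaleR_left_distrib)
      then show ?case using assms(2)[of "1 + t"] elim by simp
    qed
    from DERIV_cong_ev[OF refl this refl] * show ?thesis by blast
  qed
  ultimately have "?f' (0, y) = real k * f (x, y)"
    by (intro DERIV_unique)
  then show ?thesis
    by (simp add: frechet_fibre_eq_sum_ydot[OF assms(1)])
qed

text \<open>Differentiate \<open>f (x, r (y + t e)) = r f (x, y + t e)\<close> in \<open>t\<close> at 0, with \<open>e\<close> the \<open>i\<close>-th basis vector;
  both sides carry a factor \<open>r\<close>, which cancels.\<close>

lemma ydot_homogeneous:
  fixes f :: "(real ^ 'n::finite) \<times> (real ^ 'n) \<Rightarrow> real"
  assumes "\<And>y r. y \<noteq> 0 \<Longrightarrow> r > 0 \<Longrightarrow> f (x, r *\<^sub>R y) = r * f (x, y)"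
    and "\<And>y. y \<noteq> 0 \<Longrightarrow> f differentiable (at (x, y))"
    and "y \<noteq> 0" "r > 0"
  shows "ydot i f (x, r *\<^sub>R y) = ydot i f (x, y)"
proof -
  let ?e = "axis i 1 :: real ^ 'n"
  have "((\<lambda>t. f (x, r *\<^sub>R y + t *\<^sub>R (r *\<^sub>R ?e)))
      has_field_derivative frechet_derivative f (at (x, r *\<^sub>R y)) (0, r *\<^sub>R ?e)) (at 0)"
    by (intro differentiable_fibre_line assms(2)) (use assms(3,4) in simp)
  moreover have *: "((\<lambda>t. r * f (x, y + t *\<^sub>R ?e))
      has_field_derivative r * frechet_derivative f (at (x, y)) (0, ?e)) (at 0)"
    by (intro DERIV_cmult differentiable_fibre_line assms(2,3))
  have "((\<lambda>t. f (x, r *\<^sub>R y + t *\<^sub>R (r *\<^sub>R ?e)))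
      has_field_derivative r * frechet_derivative f (at (x, y)) (0, ?e)) (at 0)"
  proof -
    have "open ((\<lambda>t. y + t *\<^sub>R ?e) -` (- {0}))"
      by (intro open_vimage continuous_intros)
    then have "\<forall>\<^sub>F t in nhds 0. t \<in> (\<lambda>t. y + t *\<^sub>R ?e) -` (- {0})"
      by (rule eventually_nhds_in_open) (use assms(3) in auto)
    then have "\<forall>\<^sub>F t in nhds 0. r * f (x, y + t *\<^sub>R ?e) = f (x, r *\<^sub>R y + t *\<^sub>R (r *\<^sub>R ?e))"
    proof eventually_elim
      case (elim t)
      have "r *\<^sub>R y + t *\<^sub>R (r *\<^sub>R ?e) = r *\<^sub>R (y + t *\<^sub>R ?e)"
        by (simp add: scaleR_right_distrib mult.commute)
      then show ?case using assms(1)[of "y + t *\<^sub>R ?e" r] assms(4) elim by simp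
    qed
    from DERIV_cong_ev[OF refl this refl] * show ?thesis by blast
  qed
  ultimately have "frechet_derivative f (at (x, r *\<^sub>R y)) (0, r *\<^sub>R ?e)
      = r * frechet_derivative f (at (x, y)) (0, ?e)"
    by (rule DERIV_unique)
  moreover have df: "f differentiable (at (x, r *\<^sub>R y))" "f differentiable (at (x, y))"
    using assms by auto
  moreover have "frechet_derivative f (at (x, r *\<^sub>R y)) (0, r *\<^sub>R ?e)
      = r * frechet_derivative f (at (x, r *\<^sub>R y)) (0, ?e)"
    using linear_scale[OF linear_frechet_derivative[OF df(1)], of r "(0, ?e)"] by simp
  ultimately show ?thesis using assms(4) by (simp add: ydot_eq_frechet)
qed


section \<open>Metric and Cartan tensors through derivatives of the fundamental function\<close>

lemma metric_expand:
  assumes "smooth_on S f" "z \<in> S"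
  shows "metric f z $ i $ j = f z * ydot i (ydot j f) z + ydot i f z * ydot j f z"
proof -
  note d = smooth_on_differentiable[OF assms(1)]
    smooth_on_differentiable[OF smooth_on_ydot[OF assms(1)]]
  have p: "(\<lambda>w. f w * ydot j f w) differentiable (at z)"
    by (intro differentiable_mult d assms(2))
  have "ydot j (\<lambda>w. (f w)\<^sup>2) w = 2 * (f w * ydot j f w)" if "w \<in> S" for w
    using ydot_mult[OF d(1) d(1), OF that that] by (simp add: power2_eq_square)
  then have "ydot i (ydot j (\<lambda>w. (f w)\<^sup>2)) z = ydot i (\<lambda>w. 2 * (f w * ydot j f w)) z"
    by (rule ydot_cong[OF smooth_on_open[OF assms(1)] assms(2)])
  also have "\<dots> = ydot i (\<lambda>w. f w * ydot j f w + f w * ydot j f w) z"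
    by (simp only: mult_2)
  also have "\<dots> = 2 * ydot i (\<lambda>w. f w * ydot j f w) z"
    using ydot_add[OF p p] by simp
  also have "\<dots> = 2 * (f z * ydot i (ydot j f) z + ydot i f z * ydot j f z)"
    using ydot_mult[OF d(1) d(2), OF assms(2,2)] by simp
  finally show ?thesis by (simp add: metric_def)
qed

text \<open>The order of differentiation is kept as it comes out of the product rule. Permuting the
  indices becomes harmless once they are contracted with the same vector.\<close>

lemma cartan_expand:
  assumes "smooth_on S f" "z \<in> S"
  shows "2 * cartan f i j k z = f z * ydot k (ydot i (ydot j f)) z + ydot k f z * ydot i (ydot j f) z
     + (ydot i f z * ydot k (ydot j f) z + ydot k (ydot i f) z * ydot j f z)"
proof -
  note d = smooth_on_differentiable[OF assms(1) assms(2)]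
    smooth_on_differentiable[OF smooth_on_ydot[OF assms(1)] assms(2)]
    smooth_on_differentiable[OF smooth_on_ydot[OF smooth_on_ydot[OF assms(1)]] assms(2)]
  have "ydot k (\<lambda>w. metric f w $ i $ j) z
      = ydot k (\<lambda>w. f w * ydot i (ydot j f) w + ydot i f w * ydot j f w) z"
    by (rule ydot_cong[OF smooth_on_open[OF assms(1)] assms(2)]) (rule metric_expand[OF assms(1)])
  also have "\<dots> = ydot k (\<lambda>w. f w * ydot i (ydot j f) w) z + ydot k (\<lambda>w. ydot i f w * ydot j f w) z"
    by (rule ydot_add) (intro differentiable_mult d)+
  finally show ?thesis
    by (simp add: cartan_def ydot_mult d)
qed

text \<open>After contraction with a single vector \<open>u\<close>, the three mixed terms of the preceding expansion
  become equal, because a permutation of the indices only renames summation variables.\<close>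

lemma cartan_contract:
  fixes u :: "'n::finite \<Rightarrow> real"
  assumes "smooth_on S f" "z \<in> S"
  shows "2 * (\<Sum>k\<in>UNIV. \<Sum>j\<in>UNIV. \<Sum>i\<in>UNIV. u k * u j * u i * cartan f i j k z) =
     f z * (\<Sum>k\<in>UNIV. \<Sum>j\<in>UNIV. \<Sum>i\<in>UNIV. u k * u j * u i * ydot k (ydot i (ydot j f)) z)
     + 3 * (\<Sum>i\<in>UNIV. u i * ydot i f z) * (\<Sum>j\<in>UNIV. \<Sum>i\<in>UNIV. u i * u j * ydot i (ydot j f) z)"
proof -
  let ?a = "\<lambda>i. ydot i f z" and ?H = "\<lambda>i j. ydot i (ydot j f) z"
  let ?T = "\<lambda>k i j. ydot k (ydot i (ydot j f)) z"
  let ?Q = "(\<Sum>i\<in>UNIV. u i * ?a i) * (\<Sum>j\<in>UNIV. \<Sum>i\<in>UNIV. u i * u j * ?H i j)"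
  have e: "u k * u j * u i * (2 * cartan f i j k z) = f z * (u k * u j * u i * ?T k i j)
      + (u k * ?a k) * (u i * u j * ?H i j) + (u i * ?a i) * (u k * u j * ?H k j)
      + (u j * ?a j) * (u k * u i * ?H k i)" for i j k
    unfolding cartan_expand[OF assms] by (simp add: algebra_simps)
  have q1: "(\<Sum>k\<in>UNIV. \<Sum>j\<in>UNIV. \<Sum>i\<in>UNIV. (u k * ?a k) * (u i * u j * ?H i j)) = ?Q"
    by (simp only: sum_distrib_left[symmetric] sum_distrib_right[symmetric])
  have q2: "(\<Sum>k\<in>UNIV. \<Sum>j\<in>UNIV. \<Sum>i\<in>UNIV. (u i * ?a i) * (u k * u j * ?H k j)) = ?Q"
    by (subst sum.swap) (simp only: sum_distrib_left[symmetric] sum_distrib_right[symmetric])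
  have q3: "(\<Sum>k\<in>UNIV. \<Sum>j\<in>UNIV. \<Sum>i\<in>UNIV. (u j * ?a j) * (u k * u i * ?H k i)) = ?Q"
  proof -
    have "(\<Sum>k\<in>UNIV. \<Sum>j\<in>UNIV. \<Sum>i\<in>UNIV. (u j * ?a j) * (u k * u i * ?H k i))
        = (\<Sum>k\<in>UNIV. \<Sum>i\<in>UNIV. \<Sum>j\<in>UNIV. (u j * ?a j) * (u k * u i * ?H k i))"
      by (intro sum.cong refl sum.swap)
    then show ?thesis using q2 by simp
  qed
  have "2 * (\<Sum>k\<in>UNIV. \<Sum>j\<in>UNIV. \<Sum>i\<in>UNIV. u k * u j * u i * cartan f i j k z)
      = (\<Sum>k\<in>UNIV. \<Sum>j\<in>UNIV. \<Sum>i\<in>UNIV. u k * u j * u i * (2 * cartan f i j k z))"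
    by (simp add: sum_distrib_left algebra_simps)
  also have "\<dots> = (\<Sum>k\<in>UNIV. \<Sum>j\<in>UNIV. \<Sum>i\<in>UNIV. f z * (u k * u j * u i * ?T k i j)) + ?Q + ?Q + ?Q"
    unfolding e sum.distrib q1 q2 q3 ..
  also have "\<dots> = f z * (\<Sum>k\<in>UNIV. \<Sum>j\<in>UNIV. \<Sum>i\<in>UNIV. u k * u j * u i * ?T k i j) + 3 * ?Q"
    by (simp only: sum_distrib_left[symmetric])
  finally show ?thesis by (simp only: mult.assoc)
qed


section \<open>The Cartan tensor of a Randers change\<close>

lemma matrix_inv_inverse:
  assumes "invertible G"
  shows "G ** matrix_inv G = mat 1" "matrix_inv G ** G = mat 1"
  using someI_ex[OF assms[unfolded invertible_def]] unfolding matrix_inv_def by simp_all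

text \<open>The key identity. By the product rule, the metric tensor is
  \<open>g\<^sub>i\<^sub>j = L L\<^sub>i\<^sub>j + L\<^sub>i L\<^sub>j\<close>, and homogeneity puts \<open>y\<close> into the kernel of \<open>L\<^sub>i\<^sub>j\<close> on both sides.
  This determines all contractions of \<open>L\<^sub>i\<close> and \<open>L\<^sub>i\<^sub>j\<close> with \<open>b\<^sup>i\<close> in terms of
  \<open>L\<close>, \<open>\<beta>\<close> and \<open>m\<^sup>2\<close>; only the third order term is left undetermined, and it occurs in the two
  Cartan tensors with the coefficients \<open>L\<close> and \<open>L + \<beta>\<close>.\<close>

lemma randers_cartan_contract:
  fixes f g :: "(real ^ 'n::finite) \<times> (real ^ 'n) \<Rightarrow> real"
  defines "F \<equiv> \<lambda>w. f w + g w"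
  assumes f: "smooth_on (U \<times> (UNIV - {0})) f" and F: "smooth_on (U \<times> (UNIV - {0})) F"
    and hom: "\<And>x y r. x \<in> U \<Longrightarrow> y \<noteq> 0 \<Longrightarrow> r > 0 \<Longrightarrow> f (x, r *\<^sub>R y) = r * f (x, y)"
    and lin: "\<And>x y. x \<in> U \<Longrightarrow> g (x, y) = b_lower g x \<bullet> y"
    and z: "x \<in> U" "y \<noteq> 0" and pos: "f (x, y) \<noteq> 0"
    and inv: "invertible (metric f (x, y))"
  defines "u \<equiv> \<lambda>i. b_upper f g (x, y) $ i"
  shows "2 * (\<Sum>k\<in>UNIV. \<Sum>j\<in>UNIV. \<Sum>i\<in>UNIV. u k * u j * u i * cartan F i j k (x, y)) =
    2 * (1 + g (x, y) / f (x, y)) *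
      (\<Sum>k\<in>UNIV. \<Sum>j\<in>UNIV. \<Sum>i\<in>UNIV. u k * u j * u i * cartan f i j k (x, y))
    + 3 * (m_square f g (x, y))\<^sup>2 / f (x, y)"
proof -
  let ?S = "U \<times> (UNIV - {0 :: real ^ 'n})"
  have S: "open ?S" "(x, y) \<in> ?S" using smooth_on_open[OF f] z by auto
  note d1 = smooth_on_differentiable[OF f]
    and d2 = smooth_on_differentiable[OF smooth_on_ydot[OF f]]
    and d3 = smooth_on_differentiable[OF smooth_on_ydot[OF smooth_on_ydot[OF f]]]
  define L where "L = f (x, y)"
  define \<beta> where "\<beta> = g (x, y)"
  define b where "b = b_lower g x"
  define G where "G = metric f (x, y)"
  define H where "H = (\<chi> i j. ydot i (ydot j f) (x, y))"
  define a where "a = (\<chi> i. ydot i f (x, y))"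
  define v where "v = b_upper f g (x, y)"
  define T where "T = (\<Sum>k\<in>UNIV. \<Sum>j\<in>UNIV. \<Sum>i\<in>UNIV. u k * u j * u i * ydot k (ydot i (ydot j f)) (x, y))"
  have u: "u i = v $ i" for i by (simp add: u_def v_def)
  have L: "L \<noteq> 0" using pos by (simp add: L_def)
  have \<beta>: "\<beta> = b \<bullet> y" using lin z by (simp add: \<beta>_def b_def)

  have F1: "ydot i F w = ydot i f w + b_lower g (fst w) $ i" if wS: "w \<in> ?S" for i w
  proof -
    obtain x' y' where w: "w = (x', y')" "x' \<in> U" "y' \<noteq> 0" using wS by (cases w) auto
    have "g (x', y' + t *\<^sub>R axis i 1) = g (x', y') + t * b_lower g x' $ i" for t
      using w(2) lin by (simp add: inner_add_right inner_axis)
    then show ?thesis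
      unfolding F_def w fst_conv using d1[OF wS] w by (intro ydot_add_affine) auto
  qed
  have F2: "ydot j (ydot i F) w = ydot j (ydot i f) w" if "w \<in> ?S" for i j w
  proof -
    have "ydot j (ydot i F) w = ydot j (\<lambda>w. ydot i f w + b_lower g (fst w) $ i) w"
      using F1 by (rule ydot_cong[OF S(1) that])
    also have "\<dots> = ydot j (ydot i f) w + 0"
      using d2[OF that] by (cases w) (simp only:, intro ydot_add_affine, auto)
    finally show ?thesis by simp
  qed
  have F3: "ydot k (ydot j (ydot i F)) (x, y) = ydot k (ydot j (ydot i f)) (x, y)" for i j k
    using F2 by (rule ydot_cong[OF S])

  have G: "G $ i $ j = L * H $ i $ j + a $ i * a $ j" for i j
    unfolding G_def L_def H_def a_def using metric_expand[OF f S(2)] by simp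
  have e0: "a \<bullet> y = L"
    using euler_relation[OF d1[OF S(2)], of 1] hom z
    by (simp add: a_def L_def inner_vec_def mult.commute)
  \<comment> \<open>Euler's relation for the first fibre derivatives, which have degree 0.\<close>
  have e1: "y v* H = 0"
  proof -
    have "(\<Sum>j\<in>UNIV. y $ j * ydot j (ydot i f) (x, y)) = real 0 * ydot i f (x, y)" for i
    proof (rule euler_relation[OF d2[OF S(2)]])
      fix r :: real assume "r > 0"
      then show "ydot i f (x, r *\<^sub>R y) = r ^ 0 * ydot i f (x, y)"
        using ydot_homogeneous[of f x y r i] hom z d1 by simp
    qed
    then show ?thesis by (simp add: vec_eq_iff vector_matrix_mult_def H_def mult.commute)
  qed
  \<comment> \<open>Differentiate Euler's relation \<open>y\<^sup>j L\<^sub>j = L\<close> in the fibre.\<close>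
  have e2: "H *v y = 0"
  proof -
    have "(\<Sum>j\<in>UNIV. H $ i $ j * y $ j) = 0" for i
    proof -
      have "ydot i f (x, y) = ydot i (\<lambda>w. \<Sum>j\<in>UNIV. snd w $ j * ydot j f w) (x, y)"
      proof (rule ydot_cong[OF S])
        fix w assume w: "w \<in> ?S"
        obtain x' y' where w': "w = (x', y')" by (cases w)
        show "f w = (\<Sum>j\<in>UNIV. snd w $ j * ydot j f w)"
          using euler_relation[OF d1[OF w, unfolded w'], of 1] hom w by (simp add: w')
      qed
      also have "\<dots> = (\<Sum>j\<in>UNIV. y $ j * ydot i (ydot j f) (x, y)) + ydot i f (x, y)"
      proof -
        have h: "((\<lambda>t. ydot j f (x, y + t *\<^sub>R axis i 1)) has_field_derivative
            ydot i (ydot j f) (x, y)) (at 0)" for j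
          unfolding ydot_eq_frechet[OF d2[OF S(2)]]
          by (rule differentiable_fibre_line[OF d2[OF S(2)]])
        have "((\<lambda>t. \<Sum>j\<in>UNIV. (y + t *\<^sub>R axis i 1) $ j * ydot j f (x, y + t *\<^sub>R axis i 1))
          has_field_derivative (\<Sum>j\<in>UNIV. axis i 1 $ j * ydot j f (x, y) + y $ j * ydot i (ydot j f) (x, y))) (at 0)"
          by (auto intro!: derivative_eq_intros h sum.cong)
        moreover have "(\<Sum>j\<in>UNIV. axis i 1 $ j * ydot j f (x, y)) = ydot i f (x, y)"
          by (simp add: axis_def if_distribR if_distrib[of "\<lambda>c. c * _"] cong: if_cong)
        ultimately show ?thesis
          by (subst ydot_def) (simp add: DERIV_imp_deriv sum.distrib)
      qed
      finally show ?thesis by (simp add: H_def mult.commute)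
    qed
    then show ?thesis by (simp add: vec_eq_iff matrix_vector_mult_def)
  qed
  have GM: "G *v w = L *\<^sub>R (H *v w) + (a \<bullet> w) *\<^sub>R a" for w
    by (simp add: vec_eq_iff matrix_vector_mult_def G inner_vec_def sum.distrib
        sum_distrib_left algebra_simps)
  have yH: "y \<bullet> (H *v w) = 0" for w
    using e1 dot_lmul_matrix[of y H w] by simp
  have GI: "G ** metric_inv f (x, y) = mat 1" "metric_inv f (x, y) ** G = mat 1"
    using matrix_inv_inverse[OF inv] unfolding G_def metric_inv_def by simp_all
  have v: "v = metric_inv f (x, y) *v b"
    by (simp add: v_def b_def b_upper_def matrix_vector_mult_def)
  have Gv: "G *v v = b"
    by (simp add: v matrix_vector_mul_assoc GI)
  have yl: "y_lower f (x, y) = G *v y"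
    by (simp add: y_lower_def G_def matrix_vector_mult_def)
  have Gy: "G *v y = L *\<^sub>R a" by (simp add: GM e0 e2)
  \<comment> \<open>Evaluate \<open>y\<^sup>i g\<^sub>i\<^sub>j b\<^sup>j\<close> in two ways: as \<open>y\<^sup>i b\<^sub>i\<close>, and through the decomposition of \<open>g\<close>.\<close>
  have av: "a \<bullet> v = \<beta> / L"
  proof -
    have "\<beta> = y \<bullet> (G *v v)" by (simp add: Gv \<beta> inner_commute)
    also have "\<dots> = L * (a \<bullet> v)"
      using e0 by (simp add: GM inner_add_right yH inner_commute)
    finally show ?thesis using L by simp
  qed
  define m where "m = m_lower f g (x, y)"
  have m: "m = b - (\<beta> / L\<^sup>2) *\<^sub>R (L *\<^sub>R a)"
    by (simp add: m_def m_lower_def vec_eq_iff yl Gy b_def L_def \<beta>_def)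
  have Im: "metric_inv f (x, y) *v m = v - (\<beta> / L\<^sup>2) *\<^sub>R y"
    unfolding m Gy[symmetric]
    by (simp add: matrix_vector_mult_diff_distrib matrix_vector_mult_scaleR
        matrix_vector_mul_assoc GI v)
  have "m_square f g (x, y) = m \<bullet> (metric_inv f (x, y) *v m)"
    by (simp add: m_square_def m_def inner_vec_def matrix_vector_mult_def sum_distrib_left
        algebra_simps)
  also have "\<dots> = b \<bullet> v - \<beta>\<^sup>2 / L\<^sup>2"
    unfolding Im unfolding m using L
    by (simp add: inner_diff_left inner_diff_right av e0 \<beta>[symmetric] field_simps power2_eq_square)
  finally have M: "m_square f g (x, y) = b \<bullet> v - \<beta>\<^sup>2 / L\<^sup>2" .
  \<comment> \<open>Likewise for \<open>b\<^sup>i g\<^sub>i\<^sub>j b\<^sup>j = b\<^sup>i b\<^sub>i\<close>.\<close>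
  have Hv: "v \<bullet> (H *v v) = m_square f g (x, y) / L"
  proof -
    have "b \<bullet> v = v \<bullet> (G *v v)" by (simp add: Gv inner_commute)
    also have "\<dots> = L * (v \<bullet> (H *v v)) + \<beta>\<^sup>2 / L\<^sup>2"
      by (simp add: GM inner_add_right av inner_commute[of v a] power2_eq_square)
    finally show ?thesis unfolding M using L by (simp add: field_simps)
  qed
  have sH: "(\<Sum>j\<in>UNIV. \<Sum>i\<in>UNIV. u i * u j * ydot i (ydot j f) (x, y)) = m_square f g (x, y) / L"
  proof -
    have "(\<Sum>j\<in>UNIV. \<Sum>i\<in>UNIV. u i * u j * ydot i (ydot j f) (x, y)) = v \<bullet> (H *v v)"
      by (subst sum.swap) (simp add: inner_vec_def matrix_vector_mult_def sum_distrib_left u H_def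
          algebra_simps)
    then show ?thesis using Hv by simp
  qed
  have sa: "(\<Sum>i\<in>UNIV. u i * ydot i f (x, y)) = \<beta> / L"
    unfolding av[symmetric] by (simp add: inner_vec_def a_def u mult.commute)
  have sF: "(\<Sum>i\<in>UNIV. u i * ydot i F (x, y)) = \<beta> / L + b \<bullet> v"
    using sa by (simp add: F1[OF S(2)] distrib_left sum.distrib inner_vec_def b_def u mult.commute)
  have C: "2 * (\<Sum>k\<in>UNIV. \<Sum>j\<in>UNIV. \<Sum>i\<in>UNIV. u k * u j * u i * cartan f i j k (x, y))
      = L * T + 3 * (\<beta> / L) * (m_square f g (x, y) / L)"
    unfolding cartan_contract[OF f S(2)] sa sH T_def L_def ..
  have C': "2 * (\<Sum>k\<in>UNIV. \<Sum>j\<in>UNIV. \<Sum>i\<in>UNIV. u k * u j * u i * cartan F i j k (x, y))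
      = (L + \<beta>) * T + 3 * (\<beta> / L + b \<bullet> v) * (m_square f g (x, y) / L)"
    unfolding cartan_contract[OF F S(2)] F2[OF S(2)] F3 sF sH T_def
    by (simp add: F_def L_def \<beta>_def)
  have bv: "b \<bullet> v = m_square f g (x, y) + \<beta>\<^sup>2 / L\<^sup>2" using M by simp
  have "2 * (1 + \<beta> / L) * (\<Sum>k\<in>UNIV. \<Sum>j\<in>UNIV. \<Sum>i\<in>UNIV. u k * u j * u i * cartan f i j k (x, y))
      = (1 + \<beta> / L) * (L * T + 3 * (\<beta> / L) * (m_square f g (x, y) / L))"
    unfolding C[symmetric] by simp
  then show ?thesis
    unfolding C' bv L_def[symmetric] \<beta>_def[symmetric] using L
    by (simp add: field_simps power2_eq_square)
qed


section \<open>Bundle coordinates\<close>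

lemma chart_inv:
  assumes "is_chart c" "p \<in> fst c"
  shows "inv_into (fst c) (snd c) (snd c p) = p"
proof -
  have "inj_on (snd c) (fst c)"
    using assms(1) unfolding is_chart_def homeomorphism_def by (metis inj_on_inverseI)
  then show ?thesis using assms(2) by (rule inv_into_f_f)
qed

lemma transition_differentiable:
  assumes "smooth_atlas A" "c \<in> A" "d \<in> A" "p \<in> fst c" "p \<in> fst d"
  shows "transition c d differentiable (at (snd c p))"
  using assms unfolding smooth_atlas_def by (blast intro: smooth_on_differentiable)

text \<open>The chain rule for \<open>transition c e = transition d e \<circ> transition c d\<close>, which holds near the point
  only. It is what makes \<open>tangent_of\<close> produce tangent vectors.\<close>

lemma transition_cocycle:
  assumes A: "smooth_atlas A" "c \<in> A" "d \<in> A" "e \<in> A" and p: "p \<in> fst c" "p \<in> fst d" "p \<in> fst e"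
  shows "frechet_derivative (transition c e) (at (snd c p)) y =
    frechet_derivative (transition d e) (at (snd d p)) (frechet_derivative (transition c d) (at (snd c p)) y)"
proof -
  have ch: "is_chart c" "is_chart d" using A by (auto simp: smooth_atlas_def)
  let ?W = "snd c ` (fst c \<inter> fst d) \<inter> snd c ` (fst c \<inter> fst e)"
  have cd: "transition c d (snd c p) = snd d p"
    using chart_inv[OF ch(1) p(1)] by (simp add: transition_def)
  have "(transition c d has_derivative frechet_derivative (transition c d) (at (snd c p))) (at (snd c p))"
    "(transition d e has_derivative frechet_derivative (transition d e) (at (snd d p)))
      (at (transition c d (snd c p)))"
    unfolding cd using transition_differentiable A p frechet_derivative_works by blast+
  from diff_chain_at[OF this]
  have "(transition c e has_derivative frechet_derivative (transition d e) (at (snd d p))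
      \<circ> frechet_derivative (transition c d) (at (snd c p))) (at (snd c p))"
  proof (rule has_derivative_transform_within_open)
    show "open ?W"
      using A by (intro open_Int) (auto simp: smooth_atlas_def smooth_on_def)
    show "snd c p \<in> ?W" using p by auto
    fix q assume "q \<in> ?W"
    then obtain r r' where r: "q = snd c r" "r \<in> fst c" "r \<in> fst d" "q = snd c r'" "r' \<in> fst c" "r' \<in> fst e"
      by blast
    then have "inv_into (fst c) (snd c) q = r" "inv_into (fst c) (snd c) q = r'"
      using chart_inv[OF ch(1)] by metis+
    moreover have "inv_into (fst d) (snd d) (snd d r) = r" using chart_inv[OF ch(2)] r by auto
    ultimately show "(transition d e \<circ> transition c d) q = transition c e q"
      by (simp add: transition_def)
  qed
  from fun_cong[OF frechet_derivative_at[OF this], of y] show ?thesis by simp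
qed

lemma tangent_of_in_tangent_space:
  assumes "smooth_atlas A" "c \<in> A" "p \<in> fst c"
  shows "tangent_of A c p y \<in> tangent_space A p"
  unfolding tangent_space_def mem_Collect_eq
proof (intro conjI ballI allI impI)
  fix d e assume "d \<in> A" "e \<in> A" "p \<in> fst d \<and> p \<in> fst e"
  then show "tangent_of A c p y e
      = frechet_derivative (transition d e) (at (snd d p)) (tangent_of A c p y d)"
    using transition_cocycle[OF assms(1,2) _ _ assms(3), of d e y] by (simp add: tangent_of_def)
next
  fix d assume "d \<notin> A \<or> p \<notin> fst d"
  then show "tangent_of A c p y d = 0" by (auto simp: tangent_of_def)
qed

text \<open>A tangent vector is determined by its components in one chart. Hence the coordinate expression
  of a function, evaluated at the coordinates of a tangent vector, is the value of the function
  there.\<close>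

lemma tangent_of_component:
  assumes "v \<in> tangent_space A p" "c \<in> A" "p \<in> fst c"
  shows "tangent_of A c p (v c) = v"
proof
  fix d
  show "tangent_of A c p (v c) d = v d"
  proof (cases "d \<in> A \<and> p \<in> fst d")
    case True
    then have "v d = frechet_derivative (transition c d) (at (snd c p)) (v c)"
      using assms unfolding tangent_space_def by blast
    then show ?thesis using True by (simp add: tangent_of_def)
  next
    case False
    then have "v d = 0" using assms(1) unfolding tangent_space_def by blast
    then show ?thesis using False by (auto simp: tangent_of_def)
  qed
qed

lemma tangent_of_add:
  assumes "smooth_atlas A" "c \<in> A" "p \<in> fst c"
  shows "tangent_of A c p (y + y') = (\<lambda>d. tangent_of A c p y d + tangent_of A c p y' d)"
  using linear_frechet_derivative[OF transition_differentiable[OF assms(1,2) _ assms(3)]]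
  by (auto simp: tangent_of_def fun_eq_iff linear_add)

lemma tangent_of_scaleR:
  assumes "smooth_atlas A" "c \<in> A" "p \<in> fst c"
  shows "tangent_of A c p (r *\<^sub>R y) = (\<lambda>d. r *\<^sub>R tangent_of A c p y d)"
  using linear_frechet_derivative[OF transition_differentiable[OF assms(1,2) _ assms(3)]]
  by (auto simp: tangent_of_def fun_eq_iff linear_scale)

lemma local_expr_chart:
  assumes "is_chart c" "p \<in> fst c"
  shows "local_expr A c F (snd c p, y) = F (p, tangent_of A c p y)"
  by (simp add: local_expr_def chart_inv[OF assms])

lemma local_expr_one_form:
  assumes A: "smooth_atlas A" "c \<in> A" and \<beta>: "smooth_one_form A \<beta>" and x: "x \<in> snd c ` fst c"
  shows "local_expr A c \<beta> (x, y) = b_lower (local_expr A c \<beta>) x \<bullet> y"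
proof -
  obtain p where p: "p \<in> fst c" "x = snd c p" using x by auto
  have ch: "is_chart c" using A by (auto simp: smooth_atlas_def)
  let ?h = "\<lambda>y. local_expr A c \<beta> (x, y)"
  note t = tangent_of_in_tangent_space[OF A p(1)]
  have add: "\<beta> (p, \<lambda>d. w d + w' d) = \<beta> (p, w) + \<beta> (p, w')"
    if "w \<in> tangent_space A p" "w' \<in> tangent_space A p" for w w'
    using \<beta> that unfolding smooth_one_form_def by blast
  have scale: "\<beta> (p, \<lambda>d. r *\<^sub>R w d) = r * \<beta> (p, w)" if "w \<in> tangent_space A p" for w r
    using \<beta> that unfolding smooth_one_form_def by blast
  have lin: "linear ?h"
    by (rule linearI)
      (simp_all only: p(2) local_expr_chart[OF ch p(1)] tangent_of_add[OF A p(1)]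
        tangent_of_scaleR[OF A p(1)] add[OF t t] scale[OF t] real_scaleR_def)
  have "y = (\<Sum>j\<in>UNIV. y $ j *\<^sub>R axis j 1)"
    by (simp add: vec_eq_iff axis_def if_distrib cong: if_cong)
  then have "?h y = ?h (\<Sum>j\<in>UNIV. y $ j *\<^sub>R axis j 1)"
    by (rule arg_cong)
  then have "?h y = (\<Sum>j\<in>UNIV. y $ j * ?h (axis j 1))"
    by (simp only: linear_sum[OF lin] linear_scale[OF lin] real_scaleR_def)
  then show ?thesis by (simp add: b_lower_def inner_vec_def mult.commute)
qed

lemma local_expr_homogeneous:
  assumes L: "finsler_space A L" and c: "c \<in> A" and x: "x \<in> snd c ` fst c" and r: "r > 0"
  shows "local_expr A c L (x, r *\<^sub>R y) = r * local_expr A c L (x, y)"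
proof -
  obtain p where p: "p \<in> fst c" "x = snd c p" using x by auto
  have A: "smooth_atlas A" using L by (simp add: finsler_space_def)
  then have ch: "is_chart c" using c by (auto simp: smooth_atlas_def)
  have "L (p, \<lambda>d. r *\<^sub>R w d) = r * L (p, w)" if "w \<in> tangent_space A p" for w
    using L r that unfolding finsler_space_def by blast
  from this[OF tangent_of_in_tangent_space[OF A c p(1)]] show ?thesis
    unfolding p(2) local_expr_chart[OF ch p(1)] tangent_of_scaleR[OF A c p(1)] .
qed


theorem theorem4p2:
  fixes A :: "('m::{t2_space, second_countable_topology}, 'n::finite) chart set"
    and L \<beta> :: "'m \<times> ('m, 'n) tangent \<Rightarrow> real"
    and D :: "('m \<times> ('m, 'n) tangent) set"
  assumes "finsler_space A L"
    and "smooth_one_form A \<beta>"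
    and "finsler_space A (randers_change L \<beta>)"
    and "D \<subseteq> slit_tangent_bundle A" and "D \<noteq> {}"
    and "m_nonzero_on A D L \<beta>"
    and "b_condition A D L \<beta> L"
  shows "\<not> b_condition A D L \<beta> (randers_change L \<beta>)"
proof
  assume bF: "b_condition A D L \<beta> (randers_change L \<beta>)"
  have A: "smooth_atlas A" using assms(1) by (simp add: finsler_space_def)
  obtain p v where z: "(p, v) \<in> D" using assms(5) by auto
  then have v: "v \<in> tangent_space A p" "v \<noteq> (\<lambda>_. 0)" "(p, v) \<in> slit_tangent_bundle A"
    using assms(4) by (auto simp: slit_tangent_bundle_def)
  obtain c where c: "c \<in> A" "p \<in> fst c" using A unfolding smooth_atlas_def by blast
  have ch: "is_chart c" using A c by (auto simp: smooth_atlas_def)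
  let ?x = "snd c p" and ?y = "v c" and ?U = "snd c ` fst c"
  let ?f = "local_expr A c L" and ?g = "local_expr A c \<beta>"
  have x: "?x \<in> ?U" using c by auto
  have y: "?y \<noteq> 0"
  proof
    assume "?y = 0"
    then have "v = tangent_of A c p (0 *\<^sub>R 0)"
      using tangent_of_component[OF v(1) c] by simp
    then show False using v(2) by (simp only: tangent_of_scaleR[OF A c]) simp
  qed
  have F: "local_expr A c (randers_change L \<beta>) = (\<lambda>w. ?f w + ?g w)"
    by (auto simp: fun_eq_iff local_expr_def randers_change_def Let_def)
  define u where "u i = b_upper ?f ?g (?x, ?y) $ i" for i
  have contract: "(\<Sum>k\<in>UNIV. \<Sum>j\<in>UNIV. \<Sum>i\<in>UNIV. u k * u j * u i * cartan (local_expr A c K) i j k (?x, ?y)) = 0"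
    if "b_condition A D L \<beta> K" for K
  proof -
    have "(\<Sum>i\<in>UNIV. u i * cartan (local_expr A c K) i j k (?x, ?y)) = 0" for j k
      using that[unfolded b_condition_def, rule_format, OF z, of c j k] c
      by (simp add: coords_def u_def)
    then show ?thesis
      by (simp add: mult.assoc sum_distrib_left[symmetric])
  qed
  have pos: "?f (?x, ?y) > 0"
    using assms(1) v tangent_of_component[OF v(1) c]
    by (simp add: local_expr_chart[OF ch c(2)] finsler_space_def)
  have "2 * (\<Sum>k\<in>UNIV. \<Sum>j\<in>UNIV. \<Sum>i\<in>UNIV. u k * u j * u i * cartan (\<lambda>w. ?f w + ?g w) i j k (?x, ?y)) =
    2 * (1 + ?g (?x, ?y) / ?f (?x, ?y)) *
      (\<Sum>k\<in>UNIV. \<Sum>j\<in>UNIV. \<Sum>i\<in>UNIV. u k * u j * u i * cartan ?f i j k (?x, ?y))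
    + 3 * (m_square ?f ?g (?x, ?y))\<^sup>2 / ?f (?x, ?y)"
    unfolding u_def
  proof (rule randers_cartan_contract[OF _ _ _ _ x y])
    show "smooth_on (?U \<times> (UNIV - {0})) ?f"
      using assms(1) c by (simp add: finsler_space_def)
    show "smooth_on (?U \<times> (UNIV - {0})) (\<lambda>w. ?f w + ?g w)"
      using assms(3) c unfolding F[symmetric] by (simp add: finsler_space_def)
    show "?f (x', r *\<^sub>R y') = r * ?f (x', y')" if "x' \<in> ?U" "r > 0" for x' y' r
      using local_expr_homogeneous[OF assms(1) c(1) that] .
    show "?g (x', y') = b_lower ?g x' \<bullet> y'" if "x' \<in> ?U" for x' y'
      using local_expr_one_form[OF A c(1) assms(2) that] .
    show "?f (?x, ?y) \<noteq> 0" using pos by simp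
    show "invertible (metric ?f (?x, ?y))"
      using assms(1) c x y by (simp add: finsler_space_def)
  qed
  then have "m_square ?f ?g (?x, ?y) = 0"
    using contract[OF assms(7)] contract[OF bF] pos by (simp add: F)
  moreover have "m_square ?f ?g (?x, ?y) \<noteq> 0"
    using assms(6)[unfolded m_nonzero_on_def, rule_format, OF z, of c] c
    by (simp add: coords_def)
  ultimately show False by simp
qed

end
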